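(* It is not true that every 2-edge-connected graph of minimum degree at least three has the strong parity property; that is, there exists a 2-edge-connected graph $G$ with $\delta(G)\geq 3$ that does not have the strong parity property.
   Context: Graphs are finite and simple. For a graph $G$, $V(G)$ is its vertex set, $d_G(x)$ is the degree of the vertex $x$ in $G$, and $\delta(G)$ is the minimum degree. A graph is 2-edge-connected if it is connected and remains connected after deletion of any single edge. A spanning subgraph of $G$ is a subgraph with vertex set $V(G)$. A graph $G$ has the strong parity property if for every subset $X\subseteq V(G)$ with $|X|$ even, $G$ has a spanning subgraph $F$ with $\delta(F)\geq 1$ (every vertex has degree at least one in $F$) such that $d_F(v)\equiv 1\pmod 2$ for all $v\in X$ and $d_F(y)\equiv 0\pmod 2$ for all $y\in V(G)\setminus X$. *)

theory Defs
  imports Main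
begin

record 'a sgraph =
  vertices :: "'a set"
  edges :: "'a set set"

text \<open>An edge is the two-element set of its ends. The vertex set is required to be nonempty,
  so that the minimum degree is well defined.\<close>

definition simple_graph :: "'a sgraph \<Rightarrow> bool" where
  "simple_graph G \<longleftrightarrow>
     finite (vertices G) \<and> vertices G \<noteq> {} \<and>
     edges G \<subseteq> {{u, v} | u v. u \<in> vertices G \<and> v \<in> vertices G \<and> u \<noteq> v}"

definition degree :: "'a sgraph \<Rightarrow> 'a \<Rightarrow> nat" where
  "degree G x = card {e \<in> edges G. x \<in> e}"

definition min_degree :: "'a sgraph \<Rightarrow> nat" where
  "min_degree G = Min (degree G ` vertices G)"

definition adjacency :: "'a sgraph \<Rightarrow> ('a \<times> 'a) set" where
  "adjacency G = {(u, v). {u, v} \<in> edges G}"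

definition connected_graph :: "'a sgraph \<Rightarrow> bool" where
  "connected_graph G \<longleftrightarrow>
     (\<forall>u \<in> vertices G. \<forall>v \<in> vertices G. (u, v) \<in> (adjacency G)\<^sup>*)"

definition delete_edge :: "'a sgraph \<Rightarrow> 'a set \<Rightarrow> 'a sgraph" where
  "delete_edge G e = G\<lparr>edges := edges G - {e}\<rparr>"

definition two_edge_connected :: "'a sgraph \<Rightarrow> bool" where
  "two_edge_connected G \<longleftrightarrow>
     connected_graph G \<and> (\<forall>e \<in> edges G. connected_graph (delete_edge G e))"

definition spanning_subgraph :: "'a sgraph \<Rightarrow> 'a sgraph \<Rightarrow> bool" where
  "spanning_subgraph F G \<longleftrightarrow>
     simple_graph F \<and> vertices F = vertices G \<and> edges F \<subseteq> edges G"

definition strong_parity_property :: "'a sgraph \<Rightarrow> bool" where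
  "strong_parity_property G \<longleftrightarrow>
     (\<forall>X \<subseteq> vertices G. even (card X) \<longrightarrow>
        (\<exists>F. spanning_subgraph F G \<and> min_degree F \<ge> 1 \<and>
             (\<forall>v \<in> X. odd (degree F v)) \<and>
             (\<forall>y \<in> vertices G - X. even (degree F y))))"

end

theory Submission
  imports Defs
begin

text \<open>
  The counterexample arises from the complete graph on four \<^emph>\<open>hubs\<close> by putting a four-vertex
  gadget, a complete graph minus one edge, into each of its six edges. The result is a cubic graph
  on 28 vertices. Let \<open>X\<close> contain exactly one vertex of every gadget, so that \<open>|X| = 6\<close>.

  Suppose that \<open>F\<close> is a spanning subgraph as demanded for this \<open>X\<close>. The degrees in \<open>F\<close> of the four
  vertices of a gadget have an odd sum, so \<open>F\<close> has an odd number of edges leaving the gadget. Only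
  two edges leave it in the whole graph, hence exactly one of them is in \<open>F\<close>
  (\<open>gadget_boundary_parity\<close>). The hubs are pairwise nonadjacent, so the sum of their degrees in
  \<open>F\<close> is the number of gadget-leaving edges of \<open>F\<close>, which is 6. But no hub is in \<open>X\<close>, so each of the
  four hubs has a positive even degree in \<open>F\<close>, and the sum is at least 8.

  For 2-edge-connectedness, the vertices are numbered such that every vertex other than the first
  and the last has both a smaller and a larger neighbour, and the last is adjacent to the first and
  to a further vertex. After the deletion of any one edge, monotone paths still lead from every
  vertex to the first or to the last (\<open>two_edge_connected_if_st_numbering\<close>).
\<close>

section \<open>Two-edge-connectedness from an st-numbering\<close>

text \<open>
  After deletion of an edge \<open>{u, w}\<close> with \<open>u < w\<close>, a vertex below \<open>w\<close> can still descend to \<open>0\<close>, because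
  every downward step that starts below \<open>w\<close> uses another edge; and a vertex from \<open>w\<close> on can still
  climb to \<open>n\<close>. The edge \<open>{0, n}\<close> joins the two parts; if it is the deleted one, then the second
  neighbour of \<open>n\<close> takes over.
\<close>

lemma connected_delete_edge_if_st_numbering:
  fixes G :: "nat sgraph"
  assumes vertices: "vertices G = {..n}"
    and st_edge: "{0, n} \<in> edges G"
    and lower: "\<And>v. 0 < v \<Longrightarrow> v < n \<Longrightarrow> \<exists>x<v. {x, v} \<in> edges G"
    and upper: "\<And>v. 0 < v \<Longrightarrow> v < n \<Longrightarrow> \<exists>x>v. x \<le> n \<and> {x, v} \<in> edges G"
    and last: "\<exists>x. 0 < x \<and> x < n \<and> {x, n} \<in> edges G"
    and "u < w" "w \<le> n"
  shows "connected_graph (delete_edge G {u, w})"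
proof -
  define D where "D = adjacency (delete_edge G {u, w})"
  have step: "(x, y) \<in> D" if "{x, y} \<in> edges G" "{x, y} \<noteq> {u, w}" for x y
    using that by (simp add: D_def adjacency_def delete_edge_def)
  have "sym D"
    by (auto simp: D_def adjacency_def sym_def insert_commute)
  then have sym: "(y, x) \<in> D\<^sup>*" if "(x, y) \<in> D\<^sup>*" for x y
    using that by (meson sym_rtrancl symD)
  have down: "(v, 0) \<in> D\<^sup>*" if "v < w" for v
    using that
  proof (induction v rule: less_induct)
    case (less v)
    show ?case
    proof (cases "v = 0")
      case False
      then obtain x where x: "x < v" "{x, v} \<in> edges G"
        using lower[of v] less.prems \<open>w \<le> n\<close> by auto
      have "{v, x} \<noteq> {u, w}"
        using x(1) less.prems by (auto simp: doubleton_eq_iff)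
      then have "(v, x) \<in> D"
        using x(2) step[of v x] by (simp add: insert_commute)
      then show ?thesis
        using less.IH[of x] x(1) less.prems by (meson converse_rtrancl_into_rtrancl less_trans)
    qed simp
  qed
  have up: "(v, n) \<in> D\<^sup>*" if "w \<le> v" "v \<le> n" for v
    using that
  proof (induction "n - v" arbitrary: v rule: less_induct)
    case less
    show ?case
    proof (cases "v = n")
      case False
      then obtain x where x: "v < x" "x \<le> n" "{x, v} \<in> edges G"
        using upper[of v] less.prems \<open>u < w\<close> by auto
      have "{v, x} \<noteq> {u, w}"
        using x(1) less.prems \<open>u < w\<close> by (auto simp: doubleton_eq_iff)
      then have "(v, x) \<in> D"
        using x(3) step[of v x] by (simp add: insert_commute)
      moreover have "(x, n) \<in> D\<^sup>*"
        using less.hyps[of x] x less.prems by linarith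
      ultimately show ?thesis
        by (rule converse_rtrancl_into_rtrancl)
    qed simp
  qed
  have join: "(n, 0) \<in> D\<^sup>*"
  proof (cases "{u, w} = {0, n}")
    case True
    then have w: "w = n"
      using \<open>u < w\<close> by (auto simp: doubleton_eq_iff)
    obtain x where x: "0 < x" "x < n" "{x, n} \<in> edges G"
      using last by blast
    have "(n, x) \<in> D"
      using x True step[of n x] by (auto simp: insert_commute doubleton_eq_iff)
    then show ?thesis
      using down[of x] x(2) w by (simp add: converse_rtrancl_into_rtrancl)
  next
    case False
    then show ?thesis
      using step[of n 0] st_edge by (auto simp: insert_commute)
  qed
  have to_0: "(v, 0) \<in> D\<^sup>*" if "v \<le> n" for v
    using down[of v] up[of v] join that by (meson not_le rtrancl_trans)
  show ?thesis
    unfolding connected_graph_def D_def[symmetric]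
    using to_0 sym vertices by (auto simp: delete_edge_def intro: rtrancl_trans)
qed

lemma two_edge_connected_if_st_numbering:
  fixes G :: "nat sgraph"
  assumes simple: "simple_graph G" and vertices: "vertices G = {..n}"
    and st_edge: "{0, n} \<in> edges G"
    and lower: "\<And>v. 0 < v \<Longrightarrow> v < n \<Longrightarrow> \<exists>x<v. {x, v} \<in> edges G"
    and upper: "\<And>v. 0 < v \<Longrightarrow> v < n \<Longrightarrow> \<exists>x>v. x \<le> n \<and> {x, v} \<in> edges G"
    and last: "\<exists>x. 0 < x \<and> x < n \<and> {x, n} \<in> edges G"
  shows "two_edge_connected G"
proof -
  note delete = connected_delete_edge_if_st_numbering[OF vertices st_edge lower upper last]
  have "connected_graph (delete_edge G {0, n})"
    using delete last by auto
  moreover have "adjacency (delete_edge G {0, n}) \<subseteq> adjacency G"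
    by (auto simp: adjacency_def delete_edge_def)
  ultimately have "connected_graph G"
    using rtrancl_mono[of "adjacency (delete_edge G {0, n})" "adjacency G"]
    unfolding connected_graph_def by (simp add: delete_edge_def subset_iff)
  moreover have "connected_graph (delete_edge G e)" if e: "e \<in> edges G" for e
  proof -
    obtain a b where "e = {a, b}" "a \<noteq> b" "a \<le> n" "b \<le> n"
      using e simple unfolding simple_graph_def vertices atMost_iff by blast
    then show ?thesis
      using delete[of a b] delete[of b a] by (metis insert_commute nat_neq_iff)
  qed
  ultimately show ?thesis
    by (simp add: two_edge_connected_def)
qed

section \<open>The cubic graph\<close>

text \<open>
  The gadget on \<open>g, \<dots>, g + 3\<close> lacks the edge \<open>{g, g + 3}\<close>; the two ends of this missing edge are joined
  to the hubs \<open>h\<close> and \<open>k\<close>, which makes all four degrees equal to 3.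
\<close>

definition gadget :: "nat \<times> nat \<times> nat \<Rightarrow> nat set list" where
  "gadget = (\<lambda>(h, g, k). [{h, g}, {g, g + 1}, {g, g + 2}, {g + 1, g + 2},
     {g + 1, g + 3}, {g + 2, g + 3}, {g + 3, k}])"

text \<open>
  The hubs are \<open>0\<close>, \<open>5\<close>, \<open>14\<close> and \<open>23\<close>. A gadget between two hubs is numbered between them, except for
  the one between \<open>0\<close> and \<open>23\<close>: it comes last, so that the first vertex \<open>0\<close> and the last vertex \<open>27\<close>
  are adjacent.
\<close>

definition gadget_edges :: "nat set list" where
  "gadget_edges = concat (map gadget
     [(0, 1, 5), (0, 6, 14), (5, 10, 14), (5, 15, 23), (14, 19, 23), (23, 24, 0)])"

definition gadget_graph :: "nat sgraph" where
  "gadget_graph = \<lparr>vertices = {..27}, edges = set gadget_edges\<rparr>"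

lemma gadget_edges_unfold:
  "gadget_edges =
    [{0, 1}, {1, 2}, {1, 3}, {2, 3}, {2, 4}, {3, 4}, {4, 5},
     {0, 6}, {6, 7}, {6, 8}, {7, 8}, {7, 9}, {8, 9}, {9, 14},
     {5, 10}, {10, 11}, {10, 12}, {11, 12}, {11, 13}, {12, 13}, {13, 14},
     {5, 15}, {15, 16}, {15, 17}, {16, 17}, {16, 18}, {17, 18}, {18, 23},
     {14, 19}, {19, 20}, {19, 21}, {20, 21}, {20, 22}, {21, 22}, {22, 23},
     {23, 24}, {24, 25}, {24, 26}, {25, 26}, {25, 27}, {26, 27}, {27, 0}]"
  by (simp add: gadget_edges_def gadget_def numeral_eq_Suc)

lemma distinct_gadget_edges: "distinct gadget_edges"
  unfolding gadget_edges_unfold by (simp add: doubleton_eq_iff)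

lemma simple_gadget_graph: "simple_graph gadget_graph"
proof -
  define E where "E = {{u, v} | u v. u \<le> 27 \<and> v \<le> 27 \<and> u \<noteq> (v :: nat)}"
  have "{u, v} \<in> E" if "u \<le> 27" "v \<le> 27" "u \<noteq> v" for u v
    using that by (auto simp: E_def)
  then have "set gadget_edges \<subseteq> E"
    by (simp add: gadget_edges_unfold)
  then show ?thesis
    by (auto simp: simple_graph_def gadget_graph_def E_def)
qed

text \<open>
  Listing the edges makes a degree in a subgraph a sum of three indicators, one for each edge of
  the cubic graph at that vertex.
\<close>

lemma degree_subgraph:
  assumes "edges F \<subseteq> edges gadget_graph"
  shows "degree F v = (\<Sum>e\<leftarrow>filter (\<lambda>e. v \<in> e) gadget_edges. of_bool (e \<in> edges F))"
proof -
  have "{e \<in> edges F. v \<in> e} = set (filter (\<lambda>e. e \<in> edges F) (filter (\<lambda>e. v \<in> e) gadget_edges))"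
    using assms by (auto simp: gadget_graph_def)
  then have "degree F v = length (filter (\<lambda>e. e \<in> edges F) (filter (\<lambda>e. v \<in> e) gadget_edges))"
    unfolding degree_def
    by (metis distinct_card distinct_filter distinct_gadget_edges)
  moreover have "length (filter P es) = (\<Sum>e\<leftarrow>es. of_bool (P e))" for P and es :: "nat set list"
    by (induction es) auto
  ultimately show ?thesis
    by (simp only:)
qed

lemma degree_gadget_graph:
  assumes "v \<le> 27"
  shows "degree gadget_graph v = 3"
proof -
  have "list_all (\<lambda>v. length (filter (\<lambda>e. v \<in> e) gadget_edges) = 3) [0..<28]"
    unfolding gadget_edges_unfold by (simp add: upt_conv_Cons)
  moreover have "v \<in> set [0..<28]"
    using assms by (simp del: upt_rec_numeral)
  moreover have "degree gadget_graph v = length (filter (\<lambda>e. v \<in> e) gadget_edges)"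
    unfolding degree_def gadget_graph_def
    by (simp add: distinct_card[symmetric] distinct_gadget_edges)
  ultimately show ?thesis
    unfolding list_all_iff by (simp only:)
qed

lemma two_edge_connected_gadget_graph: "two_edge_connected gadget_graph"
proof (rule two_edge_connected_if_st_numbering[OF simple_gadget_graph, where n = 27])
  have neighbour: "{x, v} \<in> set gadget_edges" if e: "e \<in> set gadget_edges" "v \<in> e" "x \<in> e" "x \<noteq> v"
    for e x v
  proof -
    obtain a b where "e = {a, b}"
      using e(1) simple_gadget_graph by (fastforce simp: simple_graph_def gadget_graph_def)
    with e show ?thesis
      by (auto simp: insert_commute)
  qed
  fix v :: nat assume "0 < v" "v < 27"
  then have v: "v \<in> set [1..<27]"
    by (simp del: upt_rec_numeral)
  have "list_all (\<lambda>v. \<exists>e \<in> set gadget_edges. v \<in> e \<and> (\<exists>x \<in> e. x < v)) [1..<27]"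
    unfolding gadget_edges_unfold by (simp add: upt_conv_Cons)
  with v obtain e x where "e \<in> set gadget_edges" "v \<in> e" "x \<in> e" "x < v"
    unfolding list_all_iff by blast
  with neighbour[of e v x] show "\<exists>x<v. {x, v} \<in> edges gadget_graph"
    by (auto simp: gadget_graph_def)
  have "list_all (\<lambda>v. \<exists>e \<in> set gadget_edges. v \<in> e \<and> (\<exists>x \<in> e. v < x \<and> x \<le> 27)) [1..<27]"
    unfolding gadget_edges_unfold by (simp add: upt_conv_Cons)
  with v obtain e x where "e \<in> set gadget_edges" "v \<in> e" "x \<in> e" "v < x" "x \<le> 27"
    unfolding list_all_iff by blast
  with neighbour[of e v x] show "\<exists>x>v. x \<le> 27 \<and> {x, v} \<in> edges gadget_graph"
    by (auto simp: gadget_graph_def)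
next
  have "{25, 27} \<in> edges gadget_graph"
    by (simp add: gadget_graph_def gadget_edges_unfold)
  then show "\<exists>x. 0 < x \<and> x < 27 \<and> {x, 27} \<in> edges gadget_graph"
    by (intro exI[of _ 25]) simp
qed (simp_all add: gadget_graph_def gadget_edges_unfold insert_commute)

section \<open>Failure of the strong parity property\<close>

text \<open>
  The variables count the edges of a subgraph at a gadget: \<open>p\<close> and \<open>q\<close> those to the two hubs,
  \<open>a, \<dots>, e\<close> those inside. The parities are those of the four vertices; adding them up counts every
  inside edge twice.
\<close>

lemma gadget_boundary_parity:
  fixes p q a b c d e :: nat
  assumes "odd (p + a + b)" "even (a + c + d)" "even (b + c + e)" "even (d + e + q)"
    and "p \<le> 1" "q \<le> 1"
  shows "p + q = 1"
  using assms by presburger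

lemma not_strong_parity_gadget_graph: "\<not> strong_parity_property gadget_graph"
proof
  assume "strong_parity_property gadget_graph"
  define X :: "nat set" where "X = {1, 6, 10, 15, 19, 24}"
  have "X \<subseteq> vertices gadget_graph" "even (card X)"
    by (simp_all add: X_def gadget_graph_def)
  with \<open>strong_parity_property gadget_graph\<close> obtain F
    where F: "spanning_subgraph F gadget_graph" "min_degree F \<ge> 1"
      and odd_X: "\<forall>v \<in> X. odd (degree F v)"
      and even_not_X: "\<forall>y \<in> vertices gadget_graph - X. even (degree F y)"
    unfolding strong_parity_property_def by blast
  have vertices_F: "vertices F = {..27}" and edges_F: "edges F \<subseteq> edges gadget_graph"
    using F(1) by (simp_all add: spanning_subgraph_def gadget_graph_def)
  define i :: "nat \<Rightarrow> nat \<Rightarrow> nat" where "i x y = of_bool ({x, y} \<in> edges F)" for x y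
  have i_le: "i x y \<le> 1" for x y
    by (simp add: i_def)
  have deg: "degree F v = (\<Sum>e\<leftarrow>filter (\<lambda>e. v \<in> e) gadget_edges. of_bool (e \<in> edges F))" for v
    using degree_subgraph[OF edges_F] .
  have even_deg: "even (degree F v)" if "v \<le> 27" "v \<notin> X" for v
    using even_not_X that by (simp add: gadget_graph_def)
  have odd_deg: "odd (degree F v)" if "v \<in> X" for v
    using odd_X that by simp
  have hub: "degree F v \<ge> 2" if "v \<in> {0, 5, 14, 23}" for v
  proof -
    have "v \<le> 27" "v \<notin> X"
      using that by (auto simp: X_def)
    have "min_degree F \<le> degree F v"
      unfolding min_degree_def vertices_F using \<open>v \<le> 27\<close> by (intro Min_le) auto
    then show ?thesis
      using F(2) even_deg[OF \<open>v \<le> 27\<close> \<open>v \<notin> X\<close>] by presburger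
  qed
  note degs = deg gadget_edges_unfold i_def[symmetric] add.assoc[symmetric] X_def
  have g1: "i 0 1 + i 4 5 = 1"
    using odd_deg[of 1] even_deg[of 2] even_deg[of 3] even_deg[of 4] i_le
    by (intro gadget_boundary_parity[of _ "i 1 2" "i 1 3" "i 2 3" "i 2 4" "i 3 4"])
      (simp_all add: degs)
  have g2: "i 0 6 + i 9 14 = 1"
    using odd_deg[of 6] even_deg[of 7] even_deg[of 8] even_deg[of 9] i_le
    by (intro gadget_boundary_parity[of _ "i 6 7" "i 6 8" "i 7 8" "i 7 9" "i 8 9"])
      (simp_all add: degs)
  have g3: "i 5 10 + i 13 14 = 1"
    using odd_deg[of 10] even_deg[of 11] even_deg[of 12] even_deg[of 13] i_le
    by (intro gadget_boundary_parity[of _ "i 10 11" "i 10 12" "i 11 12" "i 11 13" "i 12 13"])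
      (simp_all add: degs)
  have g4: "i 5 15 + i 18 23 = 1"
    using odd_deg[of 15] even_deg[of 16] even_deg[of 17] even_deg[of 18] i_le
    by (intro gadget_boundary_parity[of _ "i 15 16" "i 15 17" "i 16 17" "i 16 18" "i 17 18"])
      (simp_all add: degs)
  have g5: "i 14 19 + i 22 23 = 1"
    using odd_deg[of 19] even_deg[of 20] even_deg[of 21] even_deg[of 22] i_le
    by (intro gadget_boundary_parity[of _ "i 19 20" "i 19 21" "i 20 21" "i 20 22" "i 21 22"])
      (simp_all add: degs)
  have g6: "i 23 24 + i 27 0 = 1"
    using odd_deg[of 24] even_deg[of 25] even_deg[of 26] even_deg[of 27] i_le
    by (intro gadget_boundary_parity[of _ "i 24 25" "i 24 26" "i 25 26" "i 25 27" "i 26 27"])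
      (simp_all add: degs)
  have "degree F 0 + degree F 5 + degree F 14 + degree F 23
      = (i 0 1 + i 4 5) + (i 0 6 + i 9 14) + (i 5 10 + i 13 14)
        + (i 5 15 + i 18 23) + (i 14 19 + i 22 23) + (i 23 24 + i 27 0)"
    by (simp add: degs)
  also have "\<dots> = 6"
    by (simp only: g1 g2 g3 g4 g5 g6)
  finally show False
    using hub[of 0] hub[of 5] hub[of 14] hub[of 23] by simp
qed

theorem corollary5:
  "\<exists>G :: nat sgraph. simple_graph G \<and> two_edge_connected G \<and> min_degree G \<ge> 3 \<and>
     \<not> strong_parity_property G"
proof (intro exI conjI)
  have "degree gadget_graph ` vertices gadget_graph = {3}"
    using degree_gadget_graph by (force simp: gadget_graph_def)
  then show "min_degree gadget_graph \<ge> 3"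
    by (simp add: min_degree_def)
qed (fact simple_gadget_graph two_edge_connected_gadget_graph not_strong_parity_gadget_graph)+

end
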